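(* Let $(M,g)$ be the Robinson–Trautman spacetime with coordinates $(t,r,x,y)$, constants $a,b,d\in\mathbb R$ and function $f=f(x,y)$. If $f_x=0$ (i.e. $f$ is a function of $y$ only), and $f_y^2-ff_{yy}-2a+4br\neq0$ and $r\{f_y^2-ff_{yy}\}-2ar+6d\neq0$ on $M$, then the spacetime possesses Weyl conformal collineation with respect to $\xi=\frac{\partial}{\partial x}$, i.e. $\mathscr L_\xi C=0$.
   Context: Robinson–Trautman (RT) spacetime: $a,b,d\in\mathbb R$ are constants; $M=I\times J\times\Omega$ with coordinates $(x^1,x^2,x^3,x^4)=(t,r,x,y)$, where $I\subset\mathbb R$ and $J\subset\mathbb R\setminus\{0\}$ are open intervals and $\Omega\subset\mathbb R^2$ is open, connected and nonempty; $f:\Omega\to\mathbb R$ is smooth and nowhere vanishing, with subscripts denoting partial derivatives; the metric is $$g=-2\Big(a-2br-\frac dr\Big)dt^2+2\,dt\,dr-\frac{r^2}{f^2}(dx^2+dy^2).$$ ($2\,dt\,dr$ means $g_{12}=g_{21}=1$.) Curvature conventions: with $\Gamma$ the Levi-Civita connection coefficients, $R_{pqrs}=g_{p\alpha}(\partial_r\Gamma^\alpha_{qs}-\partial_s\Gamma^\alpha_{qr}+\Gamma^\beta_{qs}\Gamma^\alpha_{\beta r}-\Gamma^\beta_{qr}\Gamma^\alpha_{\beta s})$, $S_{qr}=g^{ps}R_{pqrs}$, $\kappa=g^{qr}S_{qr}$. The Kulkarni–Nomizu product is $(\phi\wedge\psi)_{pqrs}=\phi_{ps}\psi_{qr}-\phi_{pr}\psi_{qs}+\phi_{qr}\psi_{ps}-\phi_{qs}\psi_{pr}$.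 The Weyl conformal $(0,4)$ tensor (dimension 4) is $C=R-\frac12\,S\wedge g+\frac{\kappa}{6}G$ with $G=\frac12\,g\wedge g$; $\mathscr L_\xi$ is the Lie derivative of the $(0,4)$ tensor. *)

theory Defs
  imports "HOL-Analysis.Analysis"
begin

section \<open>Partial derivatives and smoothness\<close>

definition partial :: "'n::finite \<Rightarrow> (real^'n \<Rightarrow> real) \<Rightarrow> real^'n \<Rightarrow> real" where
  "partial i F z = deriv (\<lambda>h. F (z + h *\<^sub>R axis i 1)) 0"

text \<open>\<open>F\<close> is of class \<open>C\<^sup>k\<close> on \<open>S\<close>; intended for open \<open>S\<close>.\<close>

fun Ck_on :: "nat \<Rightarrow> (real^'n::finite) set \<Rightarrow> (real^'n \<Rightarrow> real) \<Rightarrow> bool" where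
  "Ck_on 0 S F \<longleftrightarrow> continuous_on S F"
| "Ck_on (Suc k) S F \<longleftrightarrow> F differentiable_on S \<and> (\<forall>i. Ck_on k S (partial i F))"

definition smooth_on :: "(real^'n::finite) set \<Rightarrow> (real^'n \<Rightarrow> real) \<Rightarrow> bool" where
  "smooth_on S F \<longleftrightarrow> (\<forall>k. Ck_on k S F)"


section \<open>Curvature of a metric in a coordinate chart\<close>

text \<open>
  A metric is given by its coordinate components: \<open>g z $ i $ j\<close> is \<open>g\<^sub>i\<^sub>j\<close> at the point \<open>z\<close>.
\<close>

type_synonym 'n tensor2 = "real^'n^'n"
type_synonym 'n tensor4 = "'n \<Rightarrow> 'n \<Rightarrow> 'n \<Rightarrow> 'n \<Rightarrow> real"

text \<open>\<open>christoffel g c i j\<close> is the connection coefficient with upper index \<open>c\<close>.\<close>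

definition christoffel ::
  "(real^'n \<Rightarrow> 'n::finite tensor2) \<Rightarrow> 'n \<Rightarrow> 'n \<Rightarrow> 'n \<Rightarrow> real^'n \<Rightarrow> real" where
  "christoffel g c i j z =
     (\<Sum>e\<in>UNIV. matrix_inv (g z) $ c $ e *
        (partial i (\<lambda>w. g w $ e $ j) z + partial j (\<lambda>w. g w $ i $ e) z
          - partial e (\<lambda>w. g w $ i $ j) z)) / 2"

definition riemann :: "(real^'n \<Rightarrow> 'n::finite tensor2) \<Rightarrow> real^'n \<Rightarrow> 'n tensor4" where
  "riemann g z p q r s =
     (\<Sum>\<alpha>\<in>UNIV. g z $ p $ \<alpha> *
        (partial r (christoffel g \<alpha> q s) z - partial s (christoffel g \<alpha> q r) z
          + (\<Sum>\<beta>\<in>UNIV. christoffel g \<beta> q s z * christoffel g \<alpha> \<beta> r z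
                     - christoffel g \<beta> q r z * christoffel g \<alpha> \<beta> s z)))"

definition ricci :: "(real^'n \<Rightarrow> 'n::finite tensor2) \<Rightarrow> real^'n \<Rightarrow> 'n tensor2" where
  "ricci g z = (\<chi> q r. \<Sum>p\<in>UNIV. \<Sum>s\<in>UNIV. matrix_inv (g z) $ p $ s * riemann g z p q r s)"

definition scalar_curvature :: "(real^'n \<Rightarrow> 'n::finite tensor2) \<Rightarrow> real^'n \<Rightarrow> real" where
  "scalar_curvature g z =
     (\<Sum>q\<in>UNIV. \<Sum>r\<in>UNIV. matrix_inv (g z) $ q $ r * ricci g z $ q $ r)"

definition kulkarni_nomizu :: "'n::finite tensor2 \<Rightarrow> 'n tensor2 \<Rightarrow> 'n tensor4" where
  "kulkarni_nomizu \<phi> \<psi> p q r s =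
     \<phi> $ p $ s * \<psi> $ q $ r - \<phi> $ p $ r * \<psi> $ q $ s
     + \<phi> $ q $ r * \<psi> $ p $ s - \<phi> $ q $ s * \<psi> $ p $ r"

text \<open>The coefficients \<open>1/2\<close> and \<open>1/6\<close> are \<open>1/(n-2)\<close> and \<open>1/((n-1)(n-2))\<close> for \<open>n = 4\<close>.\<close>

definition weyl :: "(real^4 \<Rightarrow> 4 tensor2) \<Rightarrow> real^4 \<Rightarrow> 4 tensor4" where
  "weyl g z p q r s =
     riemann g z p q r s
     - 1/2 * kulkarni_nomizu (ricci g z) (g z) p q r s
     + scalar_curvature g z / 6 * (1/2 * kulkarni_nomizu (g z) (g z) p q r s)"

definition lie_derivative4 ::
  "(real^'n \<Rightarrow> real^'n) \<Rightarrow> (real^'n \<Rightarrow> 'n::finite tensor4) \<Rightarrow> real^'n \<Rightarrow> 'n tensor4" where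
  "lie_derivative4 \<xi> T z p q r s =
     (\<Sum>\<alpha>\<in>UNIV.
        \<xi> z $ \<alpha> * partial \<alpha> (\<lambda>w. T w p q r s) z
        + T z \<alpha> q r s * partial p (\<lambda>w. \<xi> w $ \<alpha>) z
        + T z p \<alpha> r s * partial q (\<lambda>w. \<xi> w $ \<alpha>) z
        + T z p q \<alpha> s * partial r (\<lambda>w. \<xi> w $ \<alpha>) z
        + T z p q r \<alpha> * partial s (\<lambda>w. \<xi> w $ \<alpha>) z)"

definition weyl_conformal_collineation ::
  "(real^4) set \<Rightarrow> (real^4 \<Rightarrow> 4 tensor2) \<Rightarrow> (real^4 \<Rightarrow> real^4) \<Rightarrow> bool" where
  "weyl_conformal_collineation M g \<xi> \<longleftrightarrow>
     (\<forall>z\<in>M. \<forall>p q r s. lie_derivative4 \<xi> (weyl g) z p q r s = 0)"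

definition coordinate_field :: "'n::finite \<Rightarrow> real^'n \<Rightarrow> real^'n" where
  "coordinate_field i z = axis i 1"


section \<open>Robinson--Trautman spacetime\<close>

text \<open>The components \<open>1, 2, 3, 4\<close> of a point of \<open>real^4\<close> are \<open>t, r, x, y\<close>.\<close>

definition xy_part :: "real^4 \<Rightarrow> real^2" where
  "xy_part z = vector [z $ 3, z $ 4]"

definition RT_domain :: "real set \<Rightarrow> real set \<Rightarrow> (real^2) set \<Rightarrow> (real^4) set" where
  "RT_domain I J \<Omega> = {z. z $ 1 \<in> I \<and> z $ 2 \<in> J \<and> xy_part z \<in> \<Omega>}"

definition RT_metric ::
  "real \<Rightarrow> real \<Rightarrow> real \<Rightarrow> (real^2 \<Rightarrow> real) \<Rightarrow> real^4 \<Rightarrow> 4 tensor2" where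
  "RT_metric a b d f z =
     (let r = z $ 2; h = - (r\<^sup>2 / (f (xy_part z))\<^sup>2) in
      vector [vector [- 2 * (a - 2 * b * r - d / r), 1, 0, 0],
              vector [1, 0, 0, 0],
              vector [0, 0, h, 0],
              vector [0, 0, 0, h]])"

end

theory Submission
  imports Defs
begin

text \<open>
  Since \<open>f\<^sub>x = 0\<close>, the function \<open>f\<close> is constant along every segment in direction \<open>x\<close> that stays
  in \<open>\<Omega>\<close>.  Hence no component of the metric changes under a small shift of the coordinate \<open>x\<close>:
  \<open>\<partial>/\<partial>x\<close> is a Killing field.  The Weyl tensor is built from the metric by pointwise algebra and
  partial derivatives only, and both are compatible with shifts, so its components have the same
  local invariance (\<open>weyl_translate\<close>).  For a coordinate field the Lie derivative is the partial
  derivative of the components, and the derivative of a locally constant function vanishes.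

  There is no curvature to compute.  Because \<open>\<Omega>\<close> need not be convex in direction \<open>x\<close>, \<open>f\<close> need not
  be a function of \<open>y\<close> globally on \<open>\<Omega>\<close>; for this reason everything is formulated for one fixed small
  shift \<open>v\<close> on an open set.
\<close>

text \<open>
  A partial derivative depends only on the germ of the function, so agreement of \<open>F\<close> with its
  translate on an open set passes to the derivatives.  Openness of \<open>U\<close> makes the lemma iterable.
\<close>

lemma partial_translate:
  assumes "open U" "\<And>w. w \<in> U \<Longrightarrow> F (w + v) = F w" "z \<in> U"
  shows "partial i F (z + v) = partial i F z"
proof -
  have "((\<lambda>h. z + h *\<^sub>R axis i 1) \<longlongrightarrow> z + 0 *\<^sub>R axis i 1) (nhds (0::real))"
    by (intro tendsto_intros filterlim_ident)
  then have "\<forall>\<^sub>F h in nhds 0. z + h *\<^sub>R axis i 1 \<in> U"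
    using assms(1,3) topological_tendstoD by fastforce
  then have "\<forall>\<^sub>F h in nhds 0. F (z + v + h *\<^sub>R axis i 1) = F (z + h *\<^sub>R axis i 1)"
    by eventually_elim (metis add.assoc add.commute assms(2))
  then show ?thesis
    unfolding partial_def by (intro deriv_cong_ev) auto
qed

lemma christoffel_translate:
  assumes "open U" "\<And>w. w \<in> U \<Longrightarrow> g (w + v) = g w" "z \<in> U"
  shows "christoffel g c i j (z + v) = christoffel g c i j z"
proof -
  have "partial k (\<lambda>w. g w $ m $ n) (z + v) = partial k (\<lambda>w. g w $ m $ n) z" for k m n
    by (rule partial_translate[OF assms(1) _ assms(3)]) (simp add: assms(2))
  then show ?thesis
    by (simp add: christoffel_def assms(2,3))
qed

lemma riemann_translate:
  assumes "open U" "\<And>w. w \<in> U \<Longrightarrow> g (w + v) = g w" "z \<in> U"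
  shows "riemann g (z + v) = riemann g z"
proof -
  have "partial k (christoffel g c i j) (z + v) = partial k (christoffel g c i j) z" for k c i j
    using christoffel_translate[of U g v, OF assms(1,2)]
    by (rule partial_translate[OF assms(1) _ assms(3)])
  then show ?thesis
    by (intro ext) (simp add: riemann_def assms(2,3) christoffel_translate[of U g v, OF assms])
qed

lemma weyl_translate:
  assumes "open U" "\<And>w. w \<in> U \<Longrightarrow> g (w + v) = g w" "z \<in> U"
  shows "weyl g (z + v) = weyl g z"
proof -
  have "ricci g (z + v) = ricci g z"
    by (simp add: ricci_def riemann_translate[of U g v, OF assms] assms(2,3))
  moreover from this have "scalar_curvature g (z + v) = scalar_curvature g z"
    by (simp add: scalar_curvature_def assms(2,3))
  ultimately show ?thesis
    by (intro ext) (simp add: weyl_def riemann_translate[of U g v, OF assms] assms(2,3))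
qed

lemma lie_derivative4_coordinate_field:
  "lie_derivative4 (coordinate_field i) T z p q r s = partial i (\<lambda>w. T w p q r s) z"
  by (simp add: lie_derivative4_def coordinate_field_def partial_def axis_def sum.distrib
      if_distrib[of "\<lambda>c. c * _"] cong: if_cong)

text \<open>
  The components of the Weyl tensor are constant on a short segment through \<open>z\<close> in direction \<open>i\<close>,
  so their derivative along it vanishes.  The radius \<open>\<epsilon>\<close> must not depend on the shift \<open>h\<close>, since
  the derivative at \<open>z\<close> compares the values at \<open>z + h *\<^sub>R axis i 1\<close> for all small \<open>h\<close>.
\<close>

lemma weyl_conformal_collineation_coordinate_field:
  assumes "\<And>z. z \<in> M \<Longrightarrow> \<exists>\<epsilon>>0. \<forall>w\<in>ball z \<epsilon>. \<forall>h. \<bar>h\<bar> < \<epsilon> \<longrightarrow> g (w + h *\<^sub>R axis i 1) = g w"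
  shows "weyl_conformal_collineation M g (coordinate_field i)"
  unfolding weyl_conformal_collineation_def lie_derivative4_coordinate_field
proof (intro ballI allI)
  fix z p q r s
  assume "z \<in> M"
  then obtain \<epsilon> where "\<epsilon> > 0"
    and inv: "\<And>w h. w \<in> ball z \<epsilon> \<Longrightarrow> \<bar>h\<bar> < \<epsilon> \<Longrightarrow> g (w + h *\<^sub>R axis i 1) = g w"
    using assms by metis
  have "\<forall>\<^sub>F h in nhds (0::real). \<bar>h\<bar> < \<epsilon>"
    unfolding eventually_nhds_metric using \<open>\<epsilon> > 0\<close> by (auto simp: dist_real_def)
  then have "\<forall>\<^sub>F h in nhds 0. weyl g (z + h *\<^sub>R axis i 1) p q r s = weyl g z p q r s"
  proof eventually_elim
    case (elim h)
    then show ?case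
      using weyl_translate[of "ball z \<epsilon>" g "h *\<^sub>R axis i 1" z] inv \<open>\<epsilon> > 0\<close> by simp
  qed
  then have "partial i (\<lambda>w. weyl g w p q r s) z = deriv (\<lambda>h. weyl g z p q r s) (0::real)"
    unfolding partial_def by (intro deriv_cong_ev) auto
  then show "partial i (\<lambda>w. weyl g w p q r s) z = 0"
    by simp
qed

lemma constant_on_segment_if_partial_zero:
  fixes F :: "real^'n::finite \<Rightarrow> real"
  assumes "open S" "F differentiable_on S" "\<And>w. w \<in> S \<Longrightarrow> partial i F w = 0"
    and segment: "\<And>s. s \<in> closed_segment 0 h \<Longrightarrow> u + s *\<^sub>R axis i 1 \<in> S"
  shows "F (u + h *\<^sub>R axis i 1) = F u"
proof -
  have "((\<lambda>s. F (u + s *\<^sub>R axis i 1)) has_field_derivative 0) (at s within closed_segment 0 h)"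
    if "s \<in> closed_segment 0 h" for s
  proof -
    let ?w = "u + s *\<^sub>R axis i (1::real)"
    have w: "?w \<in> S"
      using segment that by simp
    then have "F differentiable (at ?w)"
      using assms(1,2) by (simp add: differentiable_on_eq_differentiable_at)
    then have "F differentiable (at (?w + 0 *\<^sub>R axis i 1))"
      by simp
    then have "(\<lambda>h. F (?w + h *\<^sub>R axis i 1)) differentiable (at (0::real))"
      by (rule differentiable_compose[of F]) (simp add: derivative_intros)
    then have "((\<lambda>h. F (?w + h *\<^sub>R axis i 1)) has_field_derivative 0) (at 0)"
      using assms(3)[OF w] unfolding partial_def
      by (metis DERIV_deriv_iff_real_differentiable)
    then have "((\<lambda>h. F (u + (s + h) *\<^sub>R axis i 1)) has_field_derivative 0) (at 0)"
      by (simp add: scaleR_add_left add.assoc)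
    then have "((\<lambda>s. F (u + s *\<^sub>R axis i 1)) has_field_derivative 0) (at s)"
      using DERIV_shift[of "\<lambda>s. F (u + s *\<^sub>R axis i 1)" 0 0 s] by (simp add: add.commute)
    then show ?thesis
      by (rule has_field_derivative_at_within)
  qed
  then obtain c where "\<forall>s\<in>closed_segment 0 h. F (u + s *\<^sub>R axis i 1) = c"
    using has_field_derivative_zero_constant[OF convex_closed_segment,
        of 0 h "\<lambda>s. F (u + s *\<^sub>R axis i 1)"] by blast
  then have "F (u + h *\<^sub>R axis i 1) = F (u + 0 *\<^sub>R axis i 1)"
    by (simp only: ends_in_segment)
  then show ?thesis
    by simp
qed

lemma xy_part_translate: "xy_part (w + h *\<^sub>R axis 3 1) = xy_part w + h *\<^sub>R axis 1 1"
  by (simp add: xy_part_def vec_eq_iff forall_2 axis_def)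

lemma continuous_on_xy_part: "continuous_on A xy_part"
proof -
  have "xy_part = (\<lambda>z. \<chi> i. if i = 1 then z $ 3 else z $ 4)"
    by (simp add: fun_eq_iff xy_part_def vec_eq_iff forall_2)
  moreover have "continuous_on A (\<lambda>z::real^4. if i = 1 then z $ 3 else z $ 4)" for i :: 2
    by (cases "i = 1") (simp_all add: continuous_on_component continuous_on_id)
  then have "continuous_on A (\<lambda>z::real^4. \<chi> i::2. if i = 1 then z $ 3 else z $ 4)"
    by (rule continuous_on_vec_lambda)
  ultimately show ?thesis
    by (simp only:)
qed

lemma open_vimage_xy_part: "open \<Omega> \<Longrightarrow> open (xy_part -` \<Omega>)"
  using open_vimage continuous_on_xy_part by blast

theorem corollary4p5:
  fixes a b d :: real
    and I J :: "real set"
    and \<Omega> :: "(real^2) set"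
    and f :: "real^2 \<Rightarrow> real"
  assumes "open I" "is_interval I"
    and "open J" "is_interval J" "0 \<notin> J"
    and "open \<Omega>" "connected \<Omega>" "\<Omega> \<noteq> {}"
    and "smooth_on \<Omega> f" "\<forall>u\<in>\<Omega>. f u \<noteq> 0"
    and "\<forall>u\<in>\<Omega>. partial 1 f u = 0"
    and "\<forall>z\<in>RT_domain I J \<Omega>. let r = z $ 2; u = xy_part z in
           (partial 2 f u)\<^sup>2 - f u * partial 2 (partial 2 f) u - 2 * a + 4 * b * r \<noteq> 0"
    and "\<forall>z\<in>RT_domain I J \<Omega>. let r = z $ 2; u = xy_part z in
           r * ((partial 2 f u)\<^sup>2 - f u * partial 2 (partial 2 f) u) - 2 * a * r + 6 * d \<noteq> 0"
  shows "weyl_conformal_collineation (RT_domain I J \<Omega>) (RT_metric a b d f) (coordinate_field 3)"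
proof (rule weyl_conformal_collineation_coordinate_field)
  fix z
  assume "z \<in> RT_domain I J \<Omega>"
  then have "z \<in> xy_part -` \<Omega>"
    by (simp add: RT_domain_def)
  then obtain \<delta> where "\<delta> > 0" and \<delta>: "ball z \<delta> \<subseteq> xy_part -` \<Omega>"
    using open_vimage_xy_part[OF \<open>open \<Omega>\<close>] openE by metis
  have diff: "f differentiable_on \<Omega>"
    using \<open>smooth_on \<Omega> f\<close> unfolding smooth_on_def by (metis Ck_on.simps(2))
  have "RT_metric a b d f (w + h *\<^sub>R axis 3 1) = RT_metric a b d f w"
    if w: "w \<in> ball z (\<delta> / 2)" and h: "\<bar>h\<bar> < \<delta> / 2" for w h
  proof -
    have "xy_part w + s *\<^sub>R axis 1 1 \<in> \<Omega>" if "s \<in> closed_segment 0 h" for s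
    proof -
      have "\<bar>s\<bar> \<le> \<bar>h\<bar>"
        using that by (auto simp: closed_segment_eq_real_ivl split: if_splits)
      then have "dist w (w + s *\<^sub>R axis 3 1) < \<delta> / 2"
        using h by (simp add: dist_norm)
      \<comment> \<open>Halving the radius leaves room for the point and its shift together.\<close>
      then have "w + s *\<^sub>R axis 3 1 \<in> ball z \<delta>"
        using w dist_triangle[of z "w + s *\<^sub>R axis 3 1" w] by simp
      then show ?thesis
        using \<delta> xy_part_translate by auto
    qed
    then have "f (xy_part (w + h *\<^sub>R axis 3 1)) = f (xy_part w)"
      unfolding xy_part_translate
      using constant_on_segment_if_partial_zero[OF \<open>open \<Omega>\<close> diff]
        \<open>\<forall>u\<in>\<Omega>. partial 1 f u = 0\<close> by blast
    moreover have "(w + h *\<^sub>R axis 3 1) $ 2 = w $ 2"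
      by (simp add: axis_def)
    ultimately show ?thesis
      by (simp only: RT_metric_def Let_def)
  qed
  then show "\<exists>\<epsilon>>0. \<forall>w\<in>ball z \<epsilon>. \<forall>h. \<bar>h\<bar> < \<epsilon> \<longrightarrow>
      RT_metric a b d f (w + h *\<^sub>R axis 3 1) = RT_metric a b d f w"
    using \<open>\<delta> > 0\<close> by (intro exI[of _ "\<delta> / 2"]) auto
qed

end
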